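(* Let $r,n\ge 1$ be integers and let $P$ be any $r$-partite $r$-pattern. Then \[\mathrm{ex}_<(n, P) = \binom{n}{r}-\binom{(n-r)_+}{r}.\]
   Context: $(x)_+=\max(x,0)$. An ordered $r$-graph is an $r$-uniform hypergraph with a total order on its vertex set. An (ordered) $r$-matching is an ordered $r$-graph in which every vertex is contained in exactly one edge; its size is its number of edges. An $r$-matching is $r$-partite if, when the vertex set is divided into $r$ contiguous intervals of equal length, every edge has exactly one vertex in each interval. An $r$-pattern is an $r$-matching of size $2$ on the vertex set $\{1,\dots,2r\}$. An ordered $r$-graph $G$ is $F$-free if it contains no (not necessarily induced) subgraph isomorphic to the ordered $r$-graph $F$ via an order-preserving isomorphism. $\mathrm{ex}_<(n,F)$ is the maximum number of edges in an $F$-free $n$-vertex ordered $r$-graph. *)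

theory Defs
  imports Complex_Main
begin

text \<open>The total order on the vertex set is the one inherited from the linearly ordered vertex type.\<close>

record 'a ordered_graph =
  verts :: "'a set"
  edges :: "'a set set"

definition ordered_rgraph :: "nat \<Rightarrow> 'a::linorder ordered_graph \<Rightarrow> bool" where
  "ordered_rgraph r G \<longleftrightarrow>
     finite (verts G) \<and> (\<forall>e\<in>edges G. e \<subseteq> verts G \<and> card e = r)"

definition ordered_subgraph :: "'a::linorder ordered_graph \<Rightarrow> 'a ordered_graph \<Rightarrow> bool" where
  "ordered_subgraph H G \<longleftrightarrow>
     verts H \<subseteq> verts G \<and> edges H \<subseteq> edges G \<and> (\<forall>e\<in>edges H. e \<subseteq> verts H)"

definition order_isomorphic ::
    "'a::linorder ordered_graph \<Rightarrow> 'b::linorder ordered_graph \<Rightarrow> bool" where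
  "order_isomorphic F H \<longleftrightarrow>
     (\<exists>f. bij_betw f (verts F) (verts H) \<and> strict_mono_on (verts F) f \<and>
          (\<lambda>e. f ` e) ` edges F = edges H)"

definition ordered_free ::
    "'a::linorder ordered_graph \<Rightarrow> 'b::linorder ordered_graph \<Rightarrow> bool" where
  "ordered_free F G \<longleftrightarrow> \<not> (\<exists>H. ordered_subgraph H G \<and> order_isomorphic F H)"

text \<open>
  Every finite totally ordered set is order-isomorphic to a set of natural numbers, so it
  suffices to let the host graphs range over those with vertices in \<open>nat\<close>.
\<close>

definition ex_edge_counts :: "nat \<Rightarrow> nat \<Rightarrow> 'a::linorder ordered_graph \<Rightarrow> nat set" where
  "ex_edge_counts r n F =
     {card (edges G) |G :: nat ordered_graph.
        ordered_rgraph r G \<and> card (verts G) = n \<and> ordered_free F G}"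

definition ex_ord :: "nat \<Rightarrow> nat \<Rightarrow> 'a::linorder ordered_graph \<Rightarrow> nat" where
  "ex_ord r n F = Max (ex_edge_counts r n F)"

text \<open>The maximum is taken over a finite set, which is nonempty as soon as \<open>F\<close> has an edge.\<close>

lemma finite_ex_edge_counts: "finite (ex_edge_counts r n F)"
proof (rule finite_subset)
  show "ex_edge_counts r n F \<subseteq> {..n choose r}"
  proof
    fix k assume "k \<in> ex_edge_counts r n F"
    then obtain G :: "nat ordered_graph" where
      G: "ordered_rgraph r G" "card (verts G) = n" and k: "k = card (edges G)"
      unfolding ex_edge_counts_def by blast
    have fin: "finite (verts G)" and
      sub: "edges G \<subseteq> {e. e \<subseteq> verts G \<and> card e = r}"
      using G(1) unfolding ordered_rgraph_def by auto
    have "k \<le> card {e. e \<subseteq> verts G \<and> card e = r}"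
      unfolding k using fin sub by (intro card_mono) auto
    also have "\<dots> = n choose r" using n_subsets[OF fin] G(2) by simp
    finally show "k \<in> {..n choose r}" by simp
  qed
qed simp

lemma ex_edge_counts_nonempty:
  assumes "edges F \<noteq> {}"
  shows "ex_edge_counts r n F \<noteq> {}"
proof -
  let ?G = "\<lparr>verts = {1..n}, edges = {}\<rparr> :: nat ordered_graph"
  have "ordered_rgraph r ?G" "card (verts ?G) = n"
    by (simp_all add: ordered_rgraph_def)
  moreover have "ordered_free F ?G"
    using assms by (auto simp: ordered_free_def ordered_subgraph_def order_isomorphic_def)
  ultimately show ?thesis unfolding ex_edge_counts_def by blast
qed

definition ordered_rmatching :: "nat \<Rightarrow> 'a::linorder ordered_graph \<Rightarrow> bool" where
  "ordered_rmatching r M \<longleftrightarrow>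
     ordered_rgraph r M \<and> (\<forall>v\<in>verts M. \<exists>!e. e \<in> edges M \<and> v \<in> e)"

text \<open>
  The sets \<open>I 0\<close>, ..., \<open>I (r - 1)\<close> are the intervals, listed from left to right.
  They are determined by \<open>r\<close> and the vertex set of \<open>M\<close>.
\<close>

definition rpartite :: "nat \<Rightarrow> 'a::linorder ordered_graph \<Rightarrow> bool" where
  "rpartite r M \<longleftrightarrow>
     (\<exists>I :: nat \<Rightarrow> 'a set.
        (\<Union>j<r. I j) = verts M \<and>
        (\<forall>j<r. \<forall>i<j. \<forall>x\<in>I i. \<forall>y\<in>I j. x < y) \<and>
        (\<forall>i<r. \<forall>j<r. card (I i) = card (I j)) \<and>
        (\<forall>e\<in>edges M. \<forall>j<r. card (e \<inter> I j) = 1))"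

definition rpattern :: "nat \<Rightarrow> nat ordered_graph \<Rightarrow> bool" where
  "rpattern r P \<longleftrightarrow>
     ordered_rmatching r P \<and> card (edges P) = 2 \<and> verts P = {1..2 * r}"

end

theory Submission
  imports Defs
begin

text \<open>
  Since \<open>P\<close> is \<open>r\<close>-partite, its two edges pick one vertex each from every interval, so the order
  type of the pair is recorded by \<open>r\<close> signs saying which edge comes first in which interval. Containing
  \<open>P\<close> therefore means containing two edges that form a \<open>pattern_pair\<close> for this sign sequence \<open>s\<close>
  (\<open>rpartite_rpattern_sign_sequence\<close>, \<open>ordered_free_iff_no_pattern_pair\<close>). The numbers
  \<open>t(n,r) = C(n - r, r)\<close>, with \<open>n - r\<close> truncated at \<open>0\<close>, satisfy
  \<open>t(n+2,r+1) = t(n+1,r+1) + t(n,r)\<close> by Pascal's rule. The upper and the lower bound both follow by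
  induction along this recursion, looking at the two largest vertices \<open>u < v\<close>.

  Upper bound (\<open>pattern_free_card_bound\<close>): merge \<open>v\<close> into \<open>u\<close>. The merged family is still
  free of the pattern, because two disjoint edges cannot both use the merged vertex, and moving the
  topmost vertex of the pair further up does not change their order type. What is lost in the merging
  are the edges containing both \<open>u\<close> and \<open>v\<close>, bounded trivially, and one edge for every set \<open>h\<close> such
  that both \<open>h + u\<close> and \<open>h + v\<close> are edges. These sets \<open>h\<close> are free of the pattern with its last
  interval removed: from a pair \<open>h, h'\<close> of that shape one gets the full pattern by giving \<open>u\<close> to
  one and \<open>v\<close> to the other, in the order the last sign demands.

  Lower bound (\<open>card_left_pattern_edges\<close>): take all \<open>r\<close>-sets that are not the first member of
  any pattern pair. The sets left out need, besides their \<open>r\<close> vertices, \<open>r\<close> further places for the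
  vertices of a partner, one next to each vertex on the side its sign prescribes; so they correspond
  to placements of \<open>r\<close> disjoint dominoes on \<open>n\<close> points, of which there are \<open>C(n - r, r)\<close>.
\<close>

section \<open>Sign sequences of partite patterns\<close>

text \<open>
  The head of the sign list belongs to the last interval, so that the recursion strips off the top
  vertex \<open>x\<close> of \<open>A\<close> and the top vertex \<open>y\<close> of \<open>B\<close>; the sign \<open>True\<close> says \<open>x < y\<close>.
\<close>

inductive pattern_pair :: "bool list \<Rightarrow> 'a::linorder set \<Rightarrow> 'a set \<Rightarrow> bool" where
  Nil: "pattern_pair [] {} {}"
| Cons: "\<lbrakk>pattern_pair s A B; if b then x < y else y < x;
          \<forall>a\<in>A \<union> B. a < x \<and> a < y\<rbrakk>
         \<Longrightarrow> pattern_pair (b # s) (insert x A) (insert y B)"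

lemma pattern_pair_swap:
  "pattern_pair s A B \<Longrightarrow> pattern_pair (map Not s) B A"
proof (induction rule: pattern_pair.induct)
  case Nil
  show ?case by (simp add: pattern_pair.Nil)
next
  case (Cons s A B b x y)
  then show ?case by (auto intro!: pattern_pair.Cons)
qed

lemma pattern_pair_image:
  assumes "pattern_pair s A B" and "strict_mono_on (A \<union> B) f"
  shows "pattern_pair s (f ` A) (f ` B)"
  using assms
proof (induction rule: pattern_pair.induct)
  case Nil
  show ?case by (simp add: pattern_pair.Nil)
next
  case (Cons s A B b x y)
  have mono: "f a < f c" if "a < c" "a \<in> insert x A \<union> insert y B" "c \<in> insert x A \<union> insert y B" for a c
    using Cons.prems that by (auto simp: strict_mono_on_def)
  have "pattern_pair s (f ` A) (f ` B)"
    using Cons.prems by (intro Cons.IH) (auto simp: strict_mono_on_def)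
  moreover have "if b then f x < f y else f y < f x"
    using Cons.hyps(2) mono by (auto split: if_splits)
  moreover have "\<forall>a\<in>f ` A \<union> f ` B. a < f x \<and> a < f y"
    using Cons.hyps(3) mono by blast
  ultimately show ?case by (simp add: pattern_pair.Cons)
qed

text \<open>
  The sign sequence determines the order type of the pair: an order isomorphism of the lower parts
  extends to the two top vertices, since these lie above everything else and the head sign fixes
  their mutual order.
\<close>

lemma pattern_pair_order_iso:
  fixes A B :: "'a::linorder set" and A' B' :: "'b::linorder set"
  assumes "pattern_pair s A B" and "pattern_pair s A' B'"
  shows "\<exists>f. strict_mono_on (A \<union> B) f \<and> f ` A = A' \<and> f ` B = B'"
  using assms
proof (induction arbitrary: A' B' rule: pattern_pair.induct)
  case Nil
  then show ?case by (auto elim: pattern_pair.cases)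
next
  case (Cons s A B b x y)
  from Cons.prems obtain x' y' A1 B1 where
    AB': "A' = insert x' A1" "B' = insert y' B1"
    and pp: "pattern_pair s A1 B1"
    and xy': "if b then x' < y' else y' < x'"
    and below': "\<forall>a\<in>A1 \<union> B1. a < x' \<and> a < y'"
    by (auto elim: pattern_pair.cases)
  obtain f where f: "strict_mono_on (A \<union> B) f" "f ` A = A1" "f ` B = B1"
    using Cons.IH[OF pp] by blast
  define g where "g = f(x := x', y := y')"
  have xy: "x \<noteq> y" using Cons.hyps(2) by (auto split: if_splits)
  have gx: "g x = x'" "g y = y'" using xy by (auto simp: g_def)
  have gf: "g a = f a" if "a \<in> A \<union> B" for a
    using Cons.hyps(3) that by (auto simp: g_def)
  have img: "g ` A = A1" "g ` B = B1"
    using f(2,3) gf by (auto simp: image_def)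
  have fin: "f a < x'" "f a < y'" if "a \<in> A \<union> B" for a
    using that f(2,3) below' by blast+
  have "g a < g c"
    if ac: "a < c" "a \<in> insert x A \<union> insert y B" "c \<in> insert x A \<union> insert y B" for a c
  proof (cases "c \<in> A \<union> B")
    case True
    with ac Cons.hyps(3) have "a \<in> A \<union> B" by (auto dest: order.asym)
    with True ac(1) f(1) gf show ?thesis by (auto simp: strict_mono_on_def)
  next
    case False
    with ac have c: "c = x \<or> c = y" by auto
    show ?thesis
    proof (cases "a \<in> A \<union> B")
      case True
      then show ?thesis using c gf fin gx by auto
    next
      case False
      with ac c Cons.hyps(2) xy' gx show ?thesis
        by (auto split: if_splits dest: order.asym)
    qed
  qed
  then have "strict_mono_on (insert x A \<union> insert y B) g"
    by (auto simp: strict_mono_on_def)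
  moreover have "g ` insert x A = A'" "g ` insert y B = B'"
    using img gx AB' by auto
  ultimately show ?case by blast
qed

text \<open>
  The signs are read off interval by interval: two disjoint transversals have distinct vertices in each
  interval, and any two vertices from different intervals are ordered as the intervals are.
\<close>

lemma transversals_pattern_pair:
  fixes I :: "nat \<Rightarrow> 'a::linorder set"
  assumes "A \<subseteq> (\<Union>j<r. I j)" and "B \<subseteq> (\<Union>j<r. I j)" and "A \<inter> B = {}"
    and "\<forall>j<r. \<forall>i<j. \<forall>x\<in>I i. \<forall>y\<in>I j. x < y"
    and "\<forall>j<r. card (A \<inter> I j) = 1" and "\<forall>j<r. card (B \<inter> I j) = 1"
  shows "\<exists>s. length s = r \<and> pattern_pair s A B"
  using assms
proof (induction r arbitrary: A B)
  case 0
  then show ?case by (auto intro: pattern_pair.Nil)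
next
  case (Suc r)
  obtain x y where x: "A \<inter> I r = {x}" and y: "B \<inter> I r = {y}"
    using Suc.prems(5,6) by (meson card_1_singletonE lessI)
  define A1 B1 where "A1 = A - {x}" and "B1 = B - {y}"
  have A: "A = insert x A1" and B: "B = insert y B1"
    using x y by (auto simp: A1_def B1_def)
  have sub: "A1 \<subseteq> (\<Union>j<r. I j)" "B1 \<subseteq> (\<Union>j<r. I j)"
  proof -
    have "(\<Union>j<Suc r. I j) = I r \<union> (\<Union>j<r. I j)" by (simp add: lessThan_Suc)
    then have "A \<subseteq> I r \<union> (\<Union>j<r. I j)" "B \<subseteq> I r \<union> (\<Union>j<r. I j)"
      using Suc.prems(1,2) by simp_all
    moreover have "A1 \<inter> I r = {}" "B1 \<inter> I r = {}" using x y by (auto simp: A1_def B1_def)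
    ultimately show "A1 \<subseteq> (\<Union>j<r. I j)" "B1 \<subseteq> (\<Union>j<r. I j)"
      unfolding A1_def B1_def by blast+
  qed
  have xI: "x \<in> I r" "y \<in> I r" using x y by auto
  have below: "\<forall>a\<in>A1 \<union> B1. a < x \<and> a < y"
  proof
    fix a assume "a \<in> A1 \<union> B1"
    then obtain j where "j < r" "a \<in> I j" using sub by auto
    then show "a < x \<and> a < y" using Suc.prems(4)[rule_format, OF lessI] xI by blast
  qed
  have meet: "A1 \<inter> I j = A \<inter> I j" "B1 \<inter> I j = B \<inter> I j" if "j < r" for j
  proof -
    have "x \<notin> I j" "y \<notin> I j" using Suc.prems(4)[rule_format, OF lessI that] xI by blast+
    then show "A1 \<inter> I j = A \<inter> I j" "B1 \<inter> I j = B \<inter> I j" by (auto simp: A1_def B1_def)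
  qed
  have "\<exists>s. length s = r \<and> pattern_pair s A1 B1"
  proof (rule Suc.IH[OF sub])
    show "A1 \<inter> B1 = {}" using Suc.prems(3) by (auto simp: A1_def B1_def)
    show "\<forall>j<r. \<forall>i<j. \<forall>x\<in>I i. \<forall>y\<in>I j. x < y" using Suc.prems(4) less_SucI by blast
    show "\<forall>j<r. card (A1 \<inter> I j) = 1" "\<forall>j<r. card (B1 \<inter> I j) = 1"
      using Suc.prems(5,6) meet by auto
  qed
  then obtain s where s: "length s = r" "pattern_pair s A1 B1" by blast
  have "x \<noteq> y" using Suc.prems(3) A B by auto
  then have "pattern_pair ((x < y) # s) A B"
    unfolding A B using s(2) below by (intro pattern_pair.Cons) auto
  then show ?case using s(1) by (intro exI[of _ "(x < y) # s"]) simp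
qed

lemma rpartite_rpattern_sign_sequence:
  assumes "rpattern r P" and "rpartite r P"
  obtains s A B where "length s = r" "pattern_pair s A B"
    "edges P = {A, B}" "verts P = A \<union> B"
proof -
  obtain A B where AB: "edges P = {A, B}" "A \<noteq> B"
    using assms(1) by (auto simp: rpattern_def card_2_iff)
  have uniq: "\<forall>v\<in>verts P. \<exists>!e. e \<in> edges P \<and> v \<in> e" and sub: "\<forall>e\<in>edges P. e \<subseteq> verts P"
    using assms(1) unfolding rpattern_def ordered_rmatching_def ordered_rgraph_def by blast+
  have verts: "verts P = A \<union> B" using uniq sub AB by blast
  have disj: "A \<inter> B = {}" using uniq sub AB by blast
  obtain I :: "nat \<Rightarrow> nat set" where I: "(\<Union>j<r. I j) = verts P"
    "\<forall>j<r. \<forall>i<j. \<forall>x\<in>I i. \<forall>y\<in>I j. x < y"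
    "\<forall>e\<in>edges P. \<forall>j<r. card (e \<inter> I j) = 1"
    using assms(2) unfolding rpartite_def by blast
  have "\<exists>s. length s = r \<and> pattern_pair s A B"
    using transversals_pattern_pair[OF _ _ disj I(2), unfolded I(1)] I(3) AB(1) verts by simp
  with that AB(1) verts show thesis by blast
qed

text \<open>
  A pattern pair \<open>C, D\<close> of edges spans the subgraph with vertex set \<open>C \<union> D\<close> and
  edges \<open>C, D\<close>, a copy of \<open>P\<close>; conversely, order-preserving maps carry pattern pairs to pattern pairs.
\<close>

lemma ordered_free_iff_no_pattern_pair:
  fixes P :: "'a::linorder ordered_graph" and G :: "'b::linorder ordered_graph"
  assumes "ordered_rgraph r G" and "pattern_pair s A B"
    and "edges P = {A, B}" and "verts P = A \<union> B"
  shows "ordered_free P G \<longleftrightarrow> \<not> (\<exists>C\<in>edges G. \<exists>D\<in>edges G. pattern_pair s C D)"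
proof -
  have "\<exists>H. ordered_subgraph H G \<and> order_isomorphic P H"
    if CD: "C \<in> edges G" "D \<in> edges G" "pattern_pair s C D" for C D
  proof -
    obtain f where f: "strict_mono_on (A \<union> B) f" "f ` A = C" "f ` B = D"
      using pattern_pair_order_iso[OF assms(2) CD(3)] by blast
    let ?H = "\<lparr>verts = C \<union> D, edges = {C, D}\<rparr>"
    have "ordered_subgraph ?H G"
      using CD assms(1) by (auto simp: ordered_subgraph_def ordered_rgraph_def)
    moreover have "bij_betw f (A \<union> B) (C \<union> D)"
      using f strict_mono_on_imp_inj_on[OF f(1)] by (auto simp: bij_betw_def)
    then have "order_isomorphic P ?H"
      unfolding order_isomorphic_def using f assms(3,4) by (intro exI[of _ f]) auto
    ultimately show ?thesis by blast
  qed
  moreover have "\<exists>C\<in>edges G. \<exists>D\<in>edges G. pattern_pair s C D"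
    if H: "ordered_subgraph H G" "order_isomorphic P H" for H
  proof -
    obtain f where f: "strict_mono_on (A \<union> B) f" "(\<lambda>e. f ` e) ` {A, B} = edges H"
      using H(2) assms(3,4) by (auto simp: order_isomorphic_def)
    have "f ` A \<in> edges G" "f ` B \<in> edges G"
      using f(2) H(1) by (auto simp: ordered_subgraph_def)
    with pattern_pair_image[OF assms(2) f(1)] show ?thesis
      by (intro bexI[of _ "f ` A"] bexI[of _ "f ` B"])
  qed
  ultimately show ?thesis unfolding ordered_free_def by blast
qed

section \<open>The recursion for the extremal number\<close>

lemma top_two_elements:
  fixes V :: "'a::linorder set"
  assumes "finite V" and "card V = Suc (Suc m)"
  obtains u v where "u \<in> V" "v \<in> V" "u < v" "\<forall>z\<in>V - {v}. z \<le> u"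
proof -
  define v where "v = Max V"
  define u where "u = Max (V - {v})"
  have "V \<noteq> {}" using assms by auto
  then have v: "v \<in> V" "\<forall>z\<in>V. z \<le> v" using assms(1) by (auto simp: v_def)
  have "card (V - {v}) = Suc m" using v assms by simp
  then have "V - {v} \<noteq> {}" by force
  then have u: "u \<in> V - {v}" using assms(1) unfolding u_def by (intro Max_in) auto
  have "\<forall>z\<in>V - {v}. z \<le> u" using assms(1) by (auto simp: u_def)
  moreover have "u < v" using u v(2) by (auto simp: order.strict_iff_order)
  ultimately show thesis using that u v by blast
qed

text \<open>
  Splitting placements of dominoes on a path by whether a domino covers the last two points gives this
  identity. Truncated subtraction is harmless: for \<open>k > m\<close> all three binomials vanish.
\<close>

lemma shifted_binomial_recursion:
  "(Suc (Suc m) - Suc k) choose Suc k = ((Suc m - Suc k) choose Suc k) + ((m - k) choose k)"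
proof (cases "k \<le> m")
  case True
  then show ?thesis by (simp add: Suc_diff_le)
next
  case False
  then show ?thesis by (cases k) (auto simp: not_le)
qed

section \<open>Upper bound\<close>

text \<open>
  Undoing the merging of \<open>v\<close> into \<open>u\<close> on one member of a pattern pair. If \<open>u\<close> is the largest vertex
  of the pair it is the top vertex of exactly one member, and raising it keeps the order type.
\<close>

lemma pattern_pair_raise_left:
  fixes A B :: "'a::linorder set"
  assumes "pattern_pair s A B" and "u \<in> A" and "\<forall>z\<in>A \<union> B. z \<le> u" and "u < v"
  shows "u \<notin> B \<and> pattern_pair s (insert v (A - {u})) B"
  using assms(1)
proof cases
  case Nil
  then show ?thesis using assms(2) by simp
next
  case (Cons t A1 B1 b x y)
  have "u = x \<or> u < x" using Cons(2,6) assms(2) by blast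
  moreover have "x \<le> u" using Cons(2) assms(3) by blast
  ultimately have x: "x = u" by auto
  have "y < u" using Cons(5) assms(3) x Cons(2,3) by (auto split: if_splits)
  moreover have "\<not> b" using Cons(5) x \<open>y < u\<close> by (auto split: if_splits)
  moreover have "A - {u} = A1" using Cons x by auto
  moreover have "\<forall>a\<in>A1 \<union> B1. a < v \<and> a < y"
    using Cons(6) x assms(4) by (auto intro: order.strict_trans)
  ultimately show ?thesis
    using Cons x assms(4) by (auto intro!: pattern_pair.Cons)
qed

lemma pattern_pair_raise_right:
  fixes A B :: "'a::linorder set"
  assumes "pattern_pair s A B" and "u \<in> B" and "\<forall>z\<in>A \<union> B. z \<le> u" and "u < v"
  shows "u \<notin> A \<and> pattern_pair s A (insert v (B - {u}))"
proof -
  have "u \<notin> A \<and> pattern_pair (map Not s) (insert v (B - {u})) A"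
    using assms by (intro pattern_pair_raise_left pattern_pair_swap) auto
  then show ?thesis using pattern_pair_swap by (fastforce simp: comp_def)
qed

text \<open>
  The additive form avoids subtraction; the recursion for \<open>C(n - r, r)\<close> then matches the three
  contributions \<open>merged\<close>, \<open>link\<close> and \<open>both\<close> term by term.
\<close>

lemma pattern_free_card_bound:
  fixes V :: "'a::linorder set"
  assumes "finite V" and "E \<subseteq> {e. e \<subseteq> V \<and> card e = length s}"
    and "\<not> (\<exists>A\<in>E. \<exists>B\<in>E. pattern_pair s A B)"
  shows "card E + ((card V - length s) choose length s) \<le> card V choose length s"
  using assms
proof (induction "card V" arbitrary: V s E rule: less_induct)
  case less
  note fin = less.prems(1) and sub = less.prems(2) and free = less.prems(3)
  have le: "card E \<le> card V choose length s"
    using card_mono[OF _ sub] n_subsets[OF fin, of "length s"] fin by simp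
  consider "s = []" | "s \<noteq> []" "card V \<le> 1"
    | b t m where "s = b # t" "card V = Suc (Suc m)"
    by (cases s; cases "card V"; cases "card V - 1") auto
  then show ?case
  proof cases
    case 1
    have "{} \<notin> E" using free 1 pattern_pair.Nil by blast
    moreover have "E \<subseteq> {{}}"
    proof
      fix e assume "e \<in> E"
      then have "e \<subseteq> V" "card e = 0" using sub 1 by auto
      then show "e \<in> {{}}" using finite_subset[OF _ fin] by simp
    qed
    ultimately have "E = {}" by blast
    then show ?thesis using 1 by simp
  next
    case 2
    then have "(card V - length s) choose length s = 0" by (cases s) auto
    then show ?thesis using le by linarith
  next
    case 3
    obtain u v where uv: "u \<in> V" "v \<in> V" "u < v" "\<forall>z\<in>V - {v}. z \<le> u"
      using top_two_elements[OF fin 3(2)] by blast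
    define W where "W = V - {u, v}"
    define k where "k = length t"
    have finE: "finite E" using sub fin finite_subset[of E "Pow V"] by auto
    have finW: "finite W" using fin by (simp add: W_def)
    have cardW: "card W = m" using uv fin 3(2) by (simp add: W_def card_Diff_subset)
    have cardV': "card (V - {v}) = Suc m" using uv fin 3(2) by simp
    have belowW: "w < u \<and> w < v" if "w \<in> W" for w
    proof -
      have "w \<le> u" "w \<noteq> u" using that uv(4) by (auto simp: W_def)
      then show ?thesis using uv(3) by auto
    qed
    have finite_edge: "finite e" "card e = Suc k" "e \<subseteq> V" if "e \<in> E" for e
    proof -
      show "card e = Suc k" and eV: "e \<subseteq> V" using that sub 3(1) by (auto simp: k_def)
      show "finite e" using eV fin by (rule finite_subset)
    qed

    \<comment> \<open>The merged family is \<open>E1 \<union> lower ` E2\<close>. An edge of it with two preimages is counted twice in \<open>E\<close>;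
      \<open>H\<close> consists of these edges without \<open>u\<close>.\<close>
    define E1 where "E1 = {e\<in>E. v \<notin> e}"
    define E2 where "E2 = {e\<in>E. v \<in> e \<and> u \<notin> e}"
    define E3 where "E3 = {e\<in>E. v \<in> e \<and> u \<in> e}"
    define lower where "lower = (\<lambda>e. insert u (e - {v}))"
    define H where "H = (\<lambda>e. e - {u}) ` (E1 \<inter> lower ` E2)"
    have raise: "insert v (e - {u}) \<in> E" "u \<in> e" if "e \<in> lower ` E2" for e
    proof -
      from that obtain e' where e': "e' \<in> E2" "e = insert u (e' - {v})"
        by (auto simp: lower_def)
      then have "insert v (e - {u}) = e'" using uv(3) by (auto simp: E2_def)
      then show "insert v (e - {u}) \<in> E" "u \<in> e" using e' by (auto simp: E2_def)
    qed
    have fins: "finite E1" "finite E2" "finite E3" using finE by (auto simp: E1_def E2_def E3_def)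
    have "card E = card E1 + card E2 + card E3"
    proof -
      have "E = (E1 \<union> E2) \<union> E3" "E1 \<inter> E2 = {}" "(E1 \<union> E2) \<inter> E3 = {}"
        by (auto simp: E1_def E2_def E3_def)
      then show ?thesis
        using card_Un_disjoint[of E1 E2] card_Un_disjoint[of "E1 \<union> E2" E3] fins by simp
    qed
    moreover have "card (lower ` E2) = card E2"
      by (intro card_image inj_on_inverseI[where g = "\<lambda>e. insert v (e - {u})"])
        (use uv(3) in \<open>auto simp: lower_def E2_def\<close>)
    moreover have "card E1 + card (lower ` E2) = card (E1 \<union> lower ` E2) + card (E1 \<inter> lower ` E2)"
      using fins by (intro card_Un_Int) auto
    moreover have "card H = card (E1 \<inter> lower ` E2)"
      unfolding H_def 
      by (intro card_image inj_on_inverseI[where g = "insert u"]) (simp add: insert_absorb raise(2))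
    ultimately have split: "card E = card (E1 \<union> lower ` E2) + card H + card E3" by simp

    have lower_edge: "lower e \<subseteq> V - {v} \<and> card (lower e) = Suc k" if "e \<in> E2" for e
    proof -
      have e: "e \<in> E" "v \<in> e" "u \<notin> e" using that by (auto simp: E2_def)
      then have "card (lower e) = card e" using finite_edge[OF e(1)] by (simp add: lower_def)
      then show ?thesis using finite_edge[OF e(1)] e uv by (auto simp: lower_def)
    qed
    have merged: "card (E1 \<union> lower ` E2) + ((Suc m - Suc k) choose Suc k) \<le> Suc m choose Suc k"
    proof -
      have "E1 \<subseteq> {e. e \<subseteq> V - {v} \<and> card e = Suc k}"
        using finite_edge by (auto simp: E1_def)
      moreover have "lower ` E2 \<subseteq> {e. e \<subseteq> V - {v} \<and> card e = Suc k}"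
        using lower_edge by blast
      ultimately have E1V: "E1 \<union> lower ` E2 \<subseteq> {e. e \<subseteq> V - {v} \<and> card e = length s}"
        using 3(1) by (simp add: k_def)
      have "\<not> (\<exists>A\<in>E1 \<union> lower ` E2. \<exists>B\<in>E1 \<union> lower ` E2. pattern_pair s A B)"
      proof (rule notI, elim bexE)
        fix A B
        assume A: "A \<in> E1 \<union> lower ` E2" and B: "B \<in> E1 \<union> lower ` E2"
          and pp: "pattern_pair s A B"
        have top: "\<forall>z\<in>A \<union> B. z \<le> u" using A B E1V uv(4) by blast
        consider "A \<in> lower ` E2" | "B \<in> lower ` E2" | "A \<in> E" "B \<in> E"
          using A B by (auto simp: E1_def)
        then show False
        proof cases
          case 1
          note up = pattern_pair_raise_left[OF pp raise(2)[OF 1] top uv(3)]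
          have "B \<in> E" using up B raise(2) by (auto simp: E1_def)
          then show False using up raise(1)[OF 1] free by blast
        next
          case 2
          note up = pattern_pair_raise_right[OF pp raise(2)[OF 2] top uv(3)]
          have "A \<in> E" using up A raise(2) by (auto simp: E1_def)
          then show False using up raise(1)[OF 2] free by blast
        next
          case 3
          then show False using free pp by blast
        qed
      qed
      then have "card (E1 \<union> lower ` E2) + ((card (V - {v}) - length s) choose length s)
          \<le> card (V - {v}) choose length s"
        using E1V fin 3(2) cardV' by (intro less.hyps) auto
      then show ?thesis using 3(1) cardV' by (simp add: k_def)
    qed

    have link: "card H + ((m - k) choose k) \<le> m choose k"
    proof -
      have H: "insert u h \<in> E \<and> insert v h \<in> E \<and> h \<subseteq> W \<and> card h = k" if "h \<in> H" for h
      proof -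
        from that obtain e where e: "e \<in> E1" "e \<in> lower ` E2" "h = e - {u}"
          by (auto simp: H_def)
        have "e \<in> E" "v \<notin> e" using e(1) by (auto simp: E1_def)
        moreover have "insert u h = e" using e(3) raise(2)[OF e(2)] by auto
        ultimately show ?thesis
          using raise[OF e(2)] e(3) finite_edge[of e] by (auto simp: W_def)
      qed
      have "\<not> (\<exists>A\<in>H. \<exists>B\<in>H. pattern_pair t A B)"
      proof (rule notI, elim bexE)
        fix A B assume A: "A \<in> H" and B: "B \<in> H" and pp: "pattern_pair t A B"
        \<comment> \<open>Both extensions of \<open>A\<close> and of \<open>B\<close> are edges, so \<open>u\<close> and \<open>v\<close> can be given out as the sign \<open>b\<close> demands.\<close>
        have "pattern_pair (b # t) (insert (if b then u else v) A) (insert (if b then v else u) B)"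
          using pp H[OF A] H[OF B] belowW uv(3) by (intro pattern_pair.Cons) auto
        moreover have "insert (if b then u else v) A \<in> E" "insert (if b then v else u) B \<in> E"
          using H[OF A] H[OF B] by auto
        ultimately show False using free 3(1) by blast
      qed
      then have "card H + ((card W - length t) choose length t) \<le> card W choose length t"
        using H finW cardW 3(2) by (intro less.hyps) (auto simp: k_def)
      then show ?thesis by (simp add: cardW k_def)
    qed

    \<comment> \<open>Without \<open>v\<close>, the edges through \<open>u\<close> and \<open>v\<close> are \<open>k\<close>-subsets of \<open>V - {v}\<close> that contain \<open>u\<close>, hence are
      distinct from the \<open>k\<close>-subsets of \<open>W\<close>. This form also covers \<open>k = 0\<close>.\<close>
    have both: "card E3 + (m choose k) \<le> Suc m choose k"
    proof -
      let ?F = "(\<lambda>e. e - {v}) ` E3" and ?K = "{e. e \<subseteq> W \<and> card e = k}"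
      have "card ?F = card E3"
        by (intro card_image inj_on_inverseI[where g = "insert v"]) (auto simp: E3_def)
      moreover have "card ?K = m choose k" using n_subsets[OF finW] cardW by simp
      moreover have "card (?F \<union> ?K) = card ?F + card ?K"
        using fins finW by (intro card_Un_disjoint) (use uv(3) in \<open>auto simp: E3_def W_def\<close>)
      moreover have "card (?F \<union> ?K) \<le> card {e. e \<subseteq> V - {v} \<and> card e = k}"
        using fin finite_edge by (intro card_mono) (auto simp: E3_def W_def)
      moreover have "card {e. e \<subseteq> V - {v} \<and> card e = k} = Suc m choose k"
        using n_subsets[of "V - {v}" k] fin cardV' by simp
      ultimately show ?thesis by simp
    qed
    show ?thesis
      unfolding 3 list.size add_Suc_right add_0_right k_def[symmetric]
      using split merged link both shifted_binomial_recursion[of m k] binomial_Suc_Suc[of "Suc m" k]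
      by linarith
  qed
qed

section \<open>Lower bound\<close>

text \<open>
  The top vertex of \<open>A\<close> can be at most \<open>p\<close>, which is \<open>u\<close> or \<open>v\<close> according to whether a partner vertex is
  needed above it. If it equals \<open>p\<close>, the other vertices of the pair lie below \<open>u\<close>; if it is smaller,
  a partner can be found that avoids \<open>v\<close>.
\<close>

lemma card_left_pattern_edges:
  fixes V :: "'a::linorder set"
  assumes "finite V"
  shows "card {A. A \<subseteq> V \<and> (\<exists>B\<subseteq>V. pattern_pair s A B)} \<le> (card V - length s) choose length s"
  using assms
proof (induction "card V" arbitrary: V s rule: less_induct)
  case less
  note fin = less.prems
  define L where "L = (\<lambda>(s :: bool list) (V :: 'a set). {A. A \<subseteq> V \<and> (\<exists>B\<subseteq>V. pattern_pair s A B)})"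
  consider "s = []" | "s \<noteq> []" "card V \<le> 1"
    | b t m where "s = b # t" "card V = Suc (Suc m)"
    by (cases s; cases "card V"; cases "card V - 1") auto
  then have "card (L s V) \<le> (card V - length s) choose length s"
  proof cases
    case 1
    then have "L s V \<subseteq> {{}}" by (auto simp: L_def elim: pattern_pair.cases)
    then have "card (L s V) \<le> card {{} :: 'a set}" by (intro card_mono) auto
    then show ?thesis using 1 by simp
  next
    case 2
    have "\<not> pattern_pair s A B" if "A \<subseteq> V" "B \<subseteq> V" for A B
    proof
      assume "pattern_pair s A B"
      then have "\<exists>x\<in>V. \<exists>y\<in>V. x \<noteq> y"
        using 2(1) that by cases (auto split: if_splits dest: order.strict_implies_not_eq)
      then obtain x y where "x \<in> V" "y \<in> V" "x \<noteq> y" by blast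
      then have "card {x, y} \<le> card V" by (intro card_mono fin) auto
      then show False using 2(2) \<open>x \<noteq> y\<close> by simp
    qed
    then have "L s V = {}" by (auto simp: L_def)
    then show ?thesis by simp
  next
    case 3
    obtain u v where uv: "u \<in> V" "v \<in> V" "u < v" "\<forall>z\<in>V - {v}. z \<le> u"
      using top_two_elements[OF fin 3(2)] by blast
    define p where "p = (if b then u else v)"
    have le_v: "\<forall>z\<in>V. z \<le> v" 
    proof
      fix z assume "z \<in> V"
      then show "z \<le> v" using uv(3) uv(4)[rule_format, of z] by (cases "z = v") auto
    qed
    have cover: "L s V \<subseteq> L s (V - {v}) \<union> insert p ` L t (V - {u, v})"
    proof
      fix A assume "A \<in> L s V"
      then obtain B where AB: "A \<subseteq> V" "B \<subseteq> V" "pattern_pair (b # t) A B"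
        using 3(1) by (auto simp: L_def)
      from AB(3) obtain x y A1 B1 where
        A: "A = insert x A1" and B: "B = insert y B1" and pp: "pattern_pair t A1 B1"
        and xy: "if b then x < y else y < x"
        and below: "\<forall>a\<in>A1 \<union> B1. a < x \<and> a < y"
        by (auto elim: pattern_pair.cases)
      have V: "x \<in> V" "y \<in> V" "A1 \<subseteq> V" "B1 \<subseteq> V" using AB A B by auto
      show "A \<in> L s (V - {v}) \<union> insert p ` L t (V - {u, v})"
      proof (cases "x = p")
        case True
        have "\<forall>a\<in>A1 \<union> B1. a < u \<and> a < v"
        proof (cases b)
          case True
          then have "x = u" using \<open>x = p\<close> by (simp add: p_def)
          then show ?thesis using below uv(3) order.strict_trans by blast
        next
          case False
          then have "y < v" using xy \<open>x = p\<close> by (simp add: p_def)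
          then have yu: "y \<le> u" "y < v" using V uv(4) by auto
          show ?thesis
          proof
            fix a assume "a \<in> A1 \<union> B1"
            then have "a < y" using below by blast
            then show "a < u \<and> a < v" using yu by auto
          qed
        qed
        then have "A1 \<subseteq> V - {u, v}" "B1 \<subseteq> V - {u, v}" using V by blast+
        then have "A1 \<in> L t (V - {u, v})" using pp unfolding L_def by blast
        then show ?thesis using A True by blast
      next
        case False
        have "x < p"
        proof (cases b)
          case True
          then have "x \<noteq> v" using xy V le_v by auto
          then have "x \<le> u" using uv(4) V by blast
          then show ?thesis using True False by (simp add: p_def)
        next
          case b: False
          then show ?thesis using False le_v V by (auto simp: p_def)
        qed
        \<comment> \<open>The partner's top vertex \<open>y\<close> may be \<open>v\<close>; if it must exceed \<open>x\<close>, the vertex \<open>u\<close> serves as well.\<close>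
        define y' where "y' = (if b then u else y)"
        have "pattern_pair (b # t) A (insert y' B1)"
          unfolding A
        proof (rule pattern_pair.Cons[OF pp])
          show "if b then x < y' else y' < x"
            using xy \<open>x < p\<close> by (auto simp: p_def y'_def)
          have "x < u" if b using that \<open>x < p\<close> by (simp add: p_def)
          then have "x < y' \<or> y' = y" by (simp add: y'_def)
          then show "\<forall>a\<in>A1 \<union> B1. a < x \<and> a < y'" using below by (auto dest: order.strict_trans)
        qed
        moreover have "A \<subseteq> V - {v} \<and> insert y' B1 \<subseteq> V - {v}"
        proof -
          have "x < v" "y' < v"
            using \<open>x < p\<close> xy uv(3) V le_v by (auto simp: p_def y'_def split: if_splits)
          moreover have "v \<notin> A1 \<union> B1" using below \<open>x < v\<close> by (auto dest: order.asym)
          moreover have "y' \<in> V" using V uv(1) by (simp add: y'_def)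
          ultimately show ?thesis using V A by blast
        qed
        ultimately have "A \<in> L s (V - {v})" unfolding L_def 3(1) by blast
        then show ?thesis by blast
      qed
    qed
    have fins: "finite (L s (V - {v}))" "finite (L t (V - {u, v}))"
      using fin by (auto simp: L_def)
    have cards: "card (V - {v}) = Suc m" "card (V - {u, v}) = m"
      using uv fin 3(2) by (auto simp: card_Diff_subset)
    have "card (L s V) \<le> card (L s (V - {v}) \<union> insert p ` L t (V - {u, v}))"
      using cover fins by (intro card_mono) auto
    also have "\<dots> \<le> card (L s (V - {v})) + card (L t (V - {u, v}))"
      using fins by (meson add_left_mono card_Un_le card_image_le order.trans)
    also have "card (L s (V - {v})) \<le> (Suc m - length s) choose length s"
      using less.hyps[of "V - {v}" s] cards fin 3(2) by (simp add: L_def)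
    also have "card (L t (V - {u, v})) \<le> (m - length t) choose length t"
      using less.hyps[of "V - {u, v}" t] cards fin 3(2) by (simp add: L_def)
    finally show ?thesis
      using shifted_binomial_recursion[of m "length t"] 3 by simp
  qed
  then show ?case by (simp add: L_def)
qed

section \<open>The extremal number\<close>

theorem theorem1p17:
  fixes r n :: nat and P :: "nat ordered_graph"
  assumes "r \<ge> 1" and "n \<ge> 1"
    and "rpattern r P" and "rpartite r P"
  shows "int (ex_ord r n P) =
           int (n choose r) - int (nat (max (int n - int r) 0) choose r)"
proof -
  obtain s A B where s: "length s = r" "pattern_pair s A B"
    and P: "edges P = {A, B}" "verts P = A \<union> B"
    using rpartite_rpattern_sign_sequence[OF assms(3,4)] .
  have upper: "k + ((n - r) choose r) \<le> n choose r" if "k \<in> ex_edge_counts r n P" for k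
  proof -
    from that obtain G :: "nat ordered_graph" where G: "ordered_rgraph r G" "card (verts G) = n"
      "ordered_free P G" and k: "k = card (edges G)"
      unfolding ex_edge_counts_def by blast
    have "\<not> (\<exists>C\<in>edges G. \<exists>D\<in>edges G. pattern_pair s C D)"
      using ordered_free_iff_no_pattern_pair[OF G(1) s(2) P] G(3) by simp
    then show ?thesis
      using pattern_free_card_bound[of "verts G" "edges G" s] G(1,2) s(1) k
      by (auto simp: ordered_rgraph_def)
  qed
  \<comment> \<open>The extremal graph: all \<open>r\<close>-sets that are not the first member of a pattern pair.\<close>
  define V where "V = {1..n}"
  define L where "L = {C. C \<subseteq> V \<and> (\<exists>D\<subseteq>V. pattern_pair s C D)}"
  define E where "E = {e. e \<subseteq> V \<and> card e = r} - L"
  let ?G = "\<lparr>verts = V, edges = E\<rparr> :: nat ordered_graph"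
  have finV: "finite V" and cardV: "card V = n" by (simp_all add: V_def)
  have G: "ordered_rgraph r ?G" using finV by (auto simp: ordered_rgraph_def E_def)
  have "\<not> (\<exists>C\<in>E. \<exists>D\<in>E. pattern_pair s C D)" unfolding E_def L_def by blast
  then have "ordered_free P ?G"
    using ordered_free_iff_no_pattern_pair[OF G s(2) P] by simp
  with G cardV have mem: "card E \<in> ex_edge_counts r n P"
    unfolding ex_edge_counts_def by (intro CollectI exI[of _ ?G]) simp
  have "card {e. e \<subseteq> V \<and> card e = r} - card L \<le> card E"
    unfolding E_def by (rule diff_card_le_card_Diff) (simp add: L_def finV)
  moreover have "card {e. e \<subseteq> V \<and> card e = r} = n choose r"
    using n_subsets[OF finV] cardV by simp
  moreover have "card L \<le> (n - r) choose r"
    using card_left_pattern_edges[OF finV, of s] s(1) cardV by (simp add: L_def)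
  ultimately have "n choose r \<le> card E + ((n - r) choose r)" by linarith
  with upper[OF mem] have card_E: "card E + ((n - r) choose r) = n choose r" by linarith
  have "k \<le> card E" if "k \<in> ex_edge_counts r n P" for k
    using upper[OF that] card_E by linarith
  then have "ex_ord r n P = card E"
    unfolding ex_ord_def using finite_ex_edge_counts mem by (intro Max_eqI)
  then have "int (ex_ord r n P) = int (n choose r) - int ((n - r) choose r)"
    using card_E by linarith
  moreover have "nat (max (int n - int r) 0) = n - r" by linarith
  ultimately show ?thesis by simp
qed

end
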